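(* Let $c \geq 1$ be a real number and let $G$ be a (possibly infinite) graph whose growth satisfies $f_G(r) \leq cr$ for every positive integer $r$. Then $G$ has stack-number at most $49c^2+30c+1$.
   Context: Graphs are undirected and may be infinite. The growth of a graph $G$ is the function $f_G\colon \mathbb{N}\to\mathbb{N}\cup\{\infty\}$ where $f_G(r)$ is the supremum of $|V(H)|$ over all subgraphs $H$ of $G$ of radius at most $r$. For an integer $k$, a $k$-stack layout of $G$ is a pair $(\leq,\varphi)$ where $\leq$ is a linear ordering of $V(G)$ and $\varphi\colon E(G)\to\{1,\dots,k\}$ is a function such that $\varphi(ux)\neq\varphi(vy)$ for any two edges $ux,vy\in E(G)$ with $u<v<x<y$. The stack-number of $G$ is the minimum integer $k\geq 0$ such that $G$ has a $k$-stack layout, or $\infty$ if no such $k$ exists. *)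

theory Defs
  imports Main "HOL-Library.Extended_Nat"
begin

definition graph :: "'a set \<Rightarrow> 'a set set \<Rightarrow> bool" where
  "graph V E \<longleftrightarrow> (\<forall>e\<in>E. \<exists>u v. e = {u, v} \<and> u \<noteq> v \<and> u \<in> V \<and> v \<in> V)"

definition subgraph :: "'a set \<Rightarrow> 'a set set \<Rightarrow> 'a set \<Rightarrow> 'a set set \<Rightarrow> bool" where
  "subgraph W F V E \<longleftrightarrow> W \<subseteq> V \<and> F \<subseteq> E \<and> (\<forall>e\<in>F. e \<subseteq> W)"

definition walk_within :: "'a set set \<Rightarrow> nat \<Rightarrow> 'a \<Rightarrow> 'a \<Rightarrow> bool" where
  "walk_within F r v w \<longleftrightarrow> (\<exists>ps. ps \<noteq> [] \<and> length ps \<le> r + 1 \<and> hd ps = v \<and> last ps = w \<and>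
      (\<forall>i. i + 1 < length ps \<longrightarrow> {ps ! i, ps ! (i + 1)} \<in> F))"

definition radius_le :: "'a set \<Rightarrow> 'a set set \<Rightarrow> nat \<Rightarrow> bool" where
  "radius_le W F r \<longleftrightarrow> (\<exists>v\<in>W. \<forall>w\<in>W. walk_within F r v w)"

definition ecard :: "'a set \<Rightarrow> enat" where
  "ecard A = (if finite A then enat (card A) else \<infinity>)"

definition growth :: "'a set \<Rightarrow> 'a set set \<Rightarrow> nat \<Rightarrow> enat" where
  "growth V E r = (SUP H \<in> {(W, F). subgraph W F V E \<and> radius_le W F r}. ecard (fst H))"

definition stack_layout :: "'a set \<Rightarrow> 'a set set \<Rightarrow> nat \<Rightarrow> ('a \<times> 'a) set \<Rightarrow> ('a set \<Rightarrow> nat) \<Rightarrow> bool" where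
  "stack_layout V E k L phi \<longleftrightarrow> linear_order_on V L \<and> (\<forall>e\<in>E. phi e \<in> {1..k}) \<and>
     (\<forall>u v x y. {u, x} \<in> E \<longrightarrow> {v, y} \<in> E \<longrightarrow>
        (u, v) \<in> L \<and> u \<noteq> v \<longrightarrow> (v, x) \<in> L \<and> v \<noteq> x \<longrightarrow> (x, y) \<in> L \<and> x \<noteq> y \<longrightarrow>
        phi {u, x} \<noteq> phi {v, y})"

definition has_stack_layout :: "'a set \<Rightarrow> 'a set set \<Rightarrow> nat \<Rightarrow> bool" where
  "has_stack_layout V E k \<longleftrightarrow> (\<exists>L phi. stack_layout V E k L phi)"

definition stack_number :: "'a set \<Rightarrow> 'a set set \<Rightarrow> enat" where
  "stack_number V E = (if \<exists>k. has_stack_layout V E k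
      then enat (LEAST k. has_stack_layout V E k) else \<infinity>)"

end

theory Submission
  imports Defs "HOL-Analysis.Function_Topology"
begin

text \<open>
  In a finite graph of linear growth, every vertex set W has a separator of size at most
  k = 14 c^2 + 3 c none of whose components carries more than half of W. Robertson and Seymour's
  recursion then splits the graph into pieces with at most 2 k + 1 outside neighbours each, using
  bags of at most 3 k + 1 vertices. List the vertices depth-first along this recursion, colour them
  with 3 k + 1 colours so that every bag is rainbow, and let an edge inherit the colour of its first
  end: this is a stack layout, since for crossing edges ux and vy with u before v, both u and v lie
  in the bag of v. A compactness argument extends the bound to infinite graphs.\<close>

subsection \<open>Compactness\<close>

text \<open>Tychonoff: the maps into \<open>{..k}\<close> form a compact space, and by
  \<open>dep\<close> those violating \<open>P F\<close> form an open set. If these open sets covered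
  the space, finitely many would; a map that \<open>ex\<close> provides for the union of the
  finitely many \<open>F\<close> then contradicts \<open>anti\<close>.\<close>

lemma compactness_finite_range:
  fixes P :: "'b set \<Rightarrow> ('i \<Rightarrow> nat) \<Rightarrow> bool"
  assumes ex: "\<And>F. finite F \<Longrightarrow> F \<subseteq> V \<Longrightarrow> \<exists>f. (\<forall>i. f i \<le> k) \<and> P F f"
    and anti: "\<And>F F' f. F \<subseteq> F' \<Longrightarrow> P F' f \<Longrightarrow> P F f"
    and dep: "\<And>F. finite F \<Longrightarrow> \<exists>J. finite J \<and> (\<forall>f g. (\<forall>i\<in>J. f i = g i) \<longrightarrow> P F f \<longrightarrow> P F g)"
  shows "\<exists>f. (\<forall>i. f i \<le> k) \<and> (\<forall>F. finite F \<longrightarrow> F \<subseteq> V \<longrightarrow> P F f)"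
proof (rule ccontr)
  assume neg: "\<not> ?thesis"
  define X where "X = product_topology (\<lambda>_::'i. discrete_topology {..k}) UNIV"
  have top: "topspace X = {f. \<forall>i. f i \<le> k}"
    by (auto simp: X_def PiE_def Pi_def)
  have comp: "compact_space X"
    by (simp add: X_def compact_space_product_topology compact_space_discrete_topology)
  define U where "U F = {f \<in> topspace X. \<not> P F f}" for F
  have opn: "openin X (U F)" if F: "finite F" for F
    unfolding X_def openin_product_topology_alt
  proof
    fix f assume f: "f \<in> U F"
    obtain J where J: "finite J" "\<And>f g. (\<forall>i\<in>J. f i = g i) \<Longrightarrow> P F f \<Longrightarrow> P F g"
      using dep[OF F] by blast
    \<comment> \<open>The basic open box of the maps that agree with \<open>f\<close> on
      \<open>J\<close>.\<close>
    define B where "B i = (if i \<in> J then {f i} else {..k})" for i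
    have fin: "finite {i \<in> UNIV. B i \<noteq> topspace (discrete_topology {..k})}"
      by (rule finite_subset[OF _ J(1)]) (auto simp: B_def)
    have fk: "f i \<le> k" for i using f by (auto simp: U_def top)
    have sub: "PiE UNIV B \<subseteq> U F"
    proof
      fix g assume "g \<in> PiE UNIV B"
      then have g: "g i \<in> B i" for i by auto
      have "g i \<le> k" for i using g[of i] fk[of i] by (auto simp: B_def split: if_splits)
      moreover have "\<forall>i\<in>J. g i = f i" using g by (metis B_def singletonD)
      ultimately show "g \<in> U F" using f J(2)[of g f] by (auto simp: U_def top)
    qed
    show "\<exists>B. finite {i \<in> UNIV. B i \<noteq> topspace (discrete_topology {..k})} \<and>
        (\<forall>i\<in>UNIV. openin (discrete_topology {..k}) (B i)) \<and> f \<in> PiE UNIV B \<and> PiE UNIV B \<subseteq> U F"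
      using fin sub fk by (intro exI[of _ B]) (auto simp: B_def)
  qed
  let ?\<U> = "U ` {F. finite F \<and> F \<subseteq> V}"
  have "topspace X \<subseteq> \<Union>?\<U>" using neg by (auto simp: U_def top)
  then obtain \<F> where \<F>: "finite \<F>" "\<F> \<subseteq> ?\<U>" "topspace X \<subseteq> \<Union>\<F>"
    using comp opn unfolding compact_space_alt by (auto elim!: allE[of _ ?\<U>])
  then obtain S where S: "finite S" "S \<subseteq> {F. finite F \<and> F \<subseteq> V}" "\<F> = U ` S"
    by (meson finite_subset_image)
  obtain f where f: "\<And>i. f i \<le> k" "P (\<Union>S) f"
    using ex[of "\<Union>S"] S by auto
  have "f \<in> topspace X" using f by (auto simp: top)
  then obtain F where "F \<in> S" "f \<in> U F" using \<F>(3) S(3) by auto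
  then show False using f(2) anti[of F "\<Union>S" f] by (auto simp: U_def)
qed

text \<open>Supplies the monotonicity that compactness asks for: the order axioms and the crossing
  condition are universal in the vertices, so they survive restriction.\<close>

lemma stack_layout_mono:
  assumes "stack_layout V {e\<in>E. e \<subseteq> V} k (L \<inter> V \<times> V) phi" "W \<subseteq> V"
  shows "stack_layout W {e\<in>E. e \<subseteq> W} k (L \<inter> W \<times> W) phi"
proof -
  let ?L = "L \<inter> V \<times> V" and ?M = "L \<inter> W \<times> W"
  have lin: "linear_order_on V ?L" and phi: "\<forall>e\<in>{e\<in>E. e \<subseteq> V}. phi e \<in> {1..k}"
    and cross: "\<And>u v x y. {u, x} \<in> {e\<in>E. e \<subseteq> V} \<Longrightarrow> {v, y} \<in> {e\<in>E. e \<subseteq> V} \<Longrightarrow>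
        (u, v) \<in> ?L \<and> u \<noteq> v \<Longrightarrow> (v, x) \<in> ?L \<and> v \<noteq> x \<Longrightarrow> (x, y) \<in> ?L \<and> x \<noteq> y \<Longrightarrow>
        phi {u, x} \<noteq> phi {v, y}"
    using assms(1) unfolding stack_layout_def by blast+
  have "?M = ?L \<inter> W \<times> W" using assms(2) by blast
  moreover have "linear_order_on W (?L \<inter> W \<times> W)"
    unfolding order_on_defs
  proof (intro conjI)
    show "refl_on W (?L \<inter> W \<times> W)"
      using lin assms(2) unfolding order_on_defs refl_on_def by blast
    show "trans (?L \<inter> W \<times> W)"
      using lin unfolding order_on_defs by (simp add: trans_Restr)
    show "antisym (?L \<inter> W \<times> W)"
      using lin unfolding order_on_defs by (simp add: antisym_Restr)
    show "total_on W (?L \<inter> W \<times> W)"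
      using lin assms(2) unfolding order_on_defs by (auto simp: total_on_def)
  qed auto
  ultimately have "linear_order_on W ?M" by simp
  moreover have "\<forall>e\<in>{e\<in>E. e \<subseteq> W}. phi e \<in> {1..k}" using phi assms(2) by auto
  moreover have "phi {u, x} \<noteq> phi {v, y}"
    if "{u, x} \<in> {e\<in>E. e \<subseteq> W}" "{v, y} \<in> {e\<in>E. e \<subseteq> W}"
      "(u, v) \<in> ?M \<and> u \<noteq> v" "(v, x) \<in> ?M \<and> v \<noteq> x" "(x, y) \<in> ?M \<and> x \<noteq> y" for u v x y
    by (rule cross) (use that assms(2) in auto)
  ultimately show ?thesis unfolding stack_layout_def by simp
qed

text \<open>A layout is encoded as a single map with boundedly many values. The map found by
  compactness is a layout of the whole graph because every axiom of a layout mentions at most four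
  vertices.\<close>

lemma has_stack_layout_compactness:
  assumes G: "graph V E"
    and fin: "\<And>F. finite F \<Longrightarrow> F \<subseteq> V \<Longrightarrow> has_stack_layout F {e\<in>E. e \<subseteq> F} k"
  shows "has_stack_layout V E k"
proof -
  \<comment> \<open>The coordinate \<open>Inl (u, v)\<close> says whether \<open>u\<close> precedes
    \<open>v\<close>; the coordinate \<open>Inr e\<close> is the colour of \<open>e\<close>.\<close>
  define L where "L f = {(u, v). f (Inl (u, v)) = (1::nat)}" for f :: "('a \<times> 'a) + 'a set \<Rightarrow> nat"
  define P where "P F f \<longleftrightarrow> stack_layout F {e\<in>E. e \<subseteq> F} k (L f \<inter> F \<times> F) (\<lambda>e. f (Inr e))" for F f
  \<comment> \<open>The bound is \<open>max 1 k\<close> because order coordinates take the value 1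
    even when \<open>k = 0\<close>.\<close>
  have "\<exists>f. (\<forall>i. f i \<le> max 1 k) \<and> (\<forall>F. finite F \<longrightarrow> F \<subseteq> V \<longrightarrow> P F f)"
  proof (rule compactness_finite_range)
    fix F assume F: "finite F" "F \<subseteq> V"
    obtain M phi where M: "stack_layout F {e\<in>E. e \<subseteq> F} k M phi"
      using fin[OF F] by (auto simp: has_stack_layout_def)
    \<comment> \<open>Off the edges inside \<open>F\<close> the colour is reset to 0, as nothing
      bounds \<open>phi\<close> there.\<close>
    define f where "f i = (case i of Inl p \<Rightarrow> if p \<in> M then 1 else 0
       | Inr e \<Rightarrow> if e \<in> E \<and> e \<subseteq> F then phi e else 0)" for i
    have MF: "M \<subseteq> F \<times> F"
      using M by (auto simp: stack_layout_def order_on_defs)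
    have Lf: "L f \<inter> F \<times> F = M" using MF by (auto simp: L_def f_def)
    have "f i \<le> max 1 k" for i
      using M by (auto simp: f_def stack_layout_def le_max_iff_disj split: sum.split)
    moreover have "P F f"
      using M unfolding P_def Lf stack_layout_def by (simp add: f_def)
    ultimately show "\<exists>f. (\<forall>i. f i \<le> max 1 k) \<and> P F f" by blast
  next
    fix F F' :: "'a set" and f assume "F \<subseteq> F'" "P F' f"
    then show "P F f" unfolding P_def by (rule stack_layout_mono[rotated])
  next
    fix F :: "'a set" assume F: "finite F"
    define J where "J = Inl ` (F \<times> F) \<union> (Inr ` Pow F :: (('a \<times> 'a) + 'a set) set)"
    have "P F g" if fg: "\<forall>i\<in>J. f i = g i" and Pf: "P F f" for f g
    proof -
      have "L g \<inter> F \<times> F = L f \<inter> F \<times> F" using fg by (auto simp: L_def J_def)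
      moreover have "f (Inr e) = g (Inr e)" if "e \<subseteq> F" for e
        using fg that by (auto simp: J_def)
      ultimately show ?thesis using Pf by (simp add: P_def stack_layout_def)
    qed
    moreover have "finite J" using F by (simp add: J_def)
    ultimately show "\<exists>J. finite J \<and> (\<forall>f g. (\<forall>i\<in>J. f i = g i) \<longrightarrow> P F f \<longrightarrow> P F g)" by blast
  qed
  then obtain f where f: "\<And>F. finite F \<Longrightarrow> F \<subseteq> V \<Longrightarrow> P F f" by blast
  let ?L = "L f \<inter> V \<times> V"
  \<comment> \<open>Each axiom is checked on the vertices it mentions, with repetitions when there
    are fewer than four.\<close>
  have P2: "P {u, v, x, y} f" if "u \<in> V" "v \<in> V" "x \<in> V" "y \<in> V" for u v x y
    using f that by simp
  have "linear_order_on V ?L"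
    unfolding order_on_defs
  proof (intro conjI)
    show "refl_on V ?L"
      unfolding refl_on_def
      using P2 by (auto simp: P_def stack_layout_def order_on_defs refl_on_def)
    show "trans ?L"
    proof (rule transI)
      fix u v x assume "(u, v) \<in> ?L" "(v, x) \<in> ?L"
      moreover from this have "trans (L f \<inter> {u,v,x,x} \<times> {u,v,x,x})"
        using P2[of u v x x] by (auto simp: P_def stack_layout_def order_on_defs)
      ultimately show "(u, x) \<in> ?L" unfolding trans_def by blast
    qed
    show "antisym ?L"
    proof (rule antisymI)
      fix u v assume "(u, v) \<in> ?L" "(v, u) \<in> ?L"
      moreover from this have "antisym (L f \<inter> {u,v,v,v} \<times> {u,v,v,v})"
        using P2[of u v v v] by (auto simp: P_def stack_layout_def order_on_defs)
      ultimately show "u = v" unfolding antisym_def by blast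
    qed
    show "total_on V ?L"
      unfolding total_on_def
    proof (intro ballI impI)
      fix u v assume "u \<in> V" "v \<in> V" "u \<noteq> v"
      moreover from this have "total_on {u,v,v,v} (L f \<inter> {u,v,v,v} \<times> {u,v,v,v})"
        using P2[of u v v v] by (auto simp: P_def stack_layout_def order_on_defs)
      ultimately show "(u, v) \<in> ?L \<or> (v, u) \<in> ?L" unfolding total_on_def by blast
    qed
  qed auto
  moreover have "f (Inr e) \<in> {1..k}" if e: "e \<in> E" for e
  proof -
    obtain u v where uv: "e = {u, v}" "u \<in> V" "v \<in> V" using G e by (auto simp: graph_def)
    then show ?thesis using P2[of u v v v] e by (auto simp: P_def stack_layout_def)
  qed
  moreover have "f (Inr {u, x}) \<noteq> f (Inr {v, y})"
    if E: "{u, x} \<in> E" "{v, y} \<in> E" and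
      o: "(u, v) \<in> ?L \<and> u \<noteq> v" "(v, x) \<in> ?L \<and> v \<noteq> x" "(x, y) \<in> ?L \<and> x \<noteq> y" for u v x y
    using P2[of u v x y] E o unfolding P_def stack_layout_def by blast
  ultimately show ?thesis unfolding has_stack_layout_def stack_layout_def
    by (intro exI[of _ ?L] exI[of _ "\<lambda>e. f (Inr e)"]) simp
qed

subsection \<open>Balanced separators\<close>

definition rball :: "'a rel \<Rightarrow> nat \<Rightarrow> 'a \<Rightarrow> 'a set" where
  "rball R n v = ((R\<^sup>=) ^^ n) `` {v}"

definition rsphere :: "'a rel \<Rightarrow> nat \<Rightarrow> 'a \<Rightarrow> 'a set" where
  "rsphere R n v = rball R n v - (\<Union>i<n. rball R i v)"

text \<open>For \<open>x\<close> outside \<open>A\<close> the value is \<open>{x}\<close>.\<close>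

definition component_in :: "'a rel \<Rightarrow> 'a set \<Rightarrow> 'a \<Rightarrow> 'a set" where
  "component_in R A x = (R \<inter> A \<times> A)\<^sup>* `` {x}"

lemma rball_0 [simp]: "rball R 0 v = {v}"
  by (auto simp: rball_def)

lemma rball_Suc: "rball R (Suc n) v = rball R n v \<union> R `` rball R n v"
  by (auto simp: rball_def)

lemma centre_in_rball: "v \<in> rball R n v"
  by (induction n) (auto simp: rball_Suc)

lemma rball_add: "x \<in> rball R m v \<Longrightarrow> y \<in> rball R n x \<Longrightarrow> y \<in> rball R (m + n) v"
  by (auto simp: rball_def relpow_add)

lemma rball_mono: "m \<le> n \<Longrightarrow> rball R m v \<subseteq> rball R n v"
  using rball_add[of _ R m v _ "n - m"] centre_in_rball[of _ R] by fastforce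

lemma rball_sym:
  assumes "sym R" "x \<in> rball R n v"
  shows "v \<in> rball R n x"
  using assms(2)
proof (induction n arbitrary: x)
  case (Suc n)
  then obtain y where y: "y \<in> rball R n v" "y = x \<or> (y, x) \<in> R" by (auto simp: rball_Suc)
  then have "y \<in> rball R 1 x" using assms(1) by (auto simp: rball_def sym_def)
  then have "v \<in> rball R (1 + n) x" using Suc.IH[OF y(1)] by (rule rball_add)
  then show ?case by simp
qed simp

lemma rball_subset: "R \<subseteq> V \<times> V \<Longrightarrow> v \<in> V \<Longrightarrow> rball R n v \<subseteq> V"
  by (induction n) (auto simp: rball_Suc)

lemma rsphere_subset: "rsphere R n v \<subseteq> rball R n v"
  by (auto simp: rsphere_def)

lemma rsphere_disjoint: "i \<noteq> j \<Longrightarrow> rsphere R i v \<inter> rsphere R j v = {}"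
  using linorder_neq_iff[of i j] by (auto simp: rsphere_def)

text \<open>Averaging: the spheres of radii \<open>m\<close> to \<open>n\<close> are disjoint and
  lie in the ball of radius \<open>n\<close>, so one of them has at most average size.\<close>

lemma ex_small_rsphere:
  assumes "finite (rball R n v)" "m \<le> n"
  shows "\<exists>i. m \<le> i \<and> i \<le> n \<and> (n + 1 - m) * card (rsphere R i v) \<le> card (rball R n v)"
proof (rule ccontr)
  assume "\<not> ?thesis"
  then have gt: "card (rball R n v) < (n + 1 - m) * card (rsphere R i v)" if "i \<in> {m..n}" for i
    using that by (meson atLeastAtMost_iff not_le)
  have sub: "rsphere R i v \<subseteq> rball R n v" if "i \<in> {m..n}" for i
    using rsphere_subset rball_mono[of i n R v] that by fastforce
  have "(\<Sum>i\<in>{m..n}. card (rsphere R i v)) = card (\<Union>i\<in>{m..n}. rsphere R i v)"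
    using finite_subset[OF sub assms(1)] rsphere_disjoint[of _ _ R v]
    by (intro card_UN_disjoint[symmetric]) blast+
  also have "\<dots> \<le> card (rball R n v)"
    using sub by (intro card_mono assms(1)) blast
  finally have le: "(\<Sum>i\<in>{m..n}. card (rsphere R i v)) \<le> card (rball R n v)" .
  have "(\<Sum>i\<in>{m..n}. card (rball R n v)) < (\<Sum>i\<in>{m..n}. (n + 1 - m) * card (rsphere R i v))"
    using assms(2) gt by (intro sum_strict_mono) auto
  also have "\<dots> = (n + 1 - m) * (\<Sum>i\<in>{m..n}. card (rsphere R i v))"
    by (simp add: sum_distrib_left)
  also have "\<dots> \<le> (n + 1 - m) * card (rball R n v)"
    using le by (rule mult_le_mono2)
  finally show False by simp
qed

text \<open>As long as a reachable vertex is still missing, each further step adds at least one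
  vertex to the ball.\<close>

lemma card_rball_ge:
  assumes "finite (rball R q v)" "w \<in> rball R n v" "w \<notin> rball R q v"
  shows "q + 1 \<le> card (rball R q v)"
  using assms
proof (induction q)
  case (Suc q)
  have fin: "finite (rball R q v)"
    using Suc.prems(1) by (simp add: rball_Suc)
  have ne: "rball R (Suc q) v \<noteq> rball R q v"
  proof
    \<comment> \<open>A ball that stops growing once never grows again, so it would never reach
      \<open>w\<close>.\<close>
    assume eq: "rball R (Suc q) v = rball R q v"
    have "rball R j v \<subseteq> rball R q v" for j
    proof (induction j)
      case (Suc j)
      then show ?case using eq by (auto simp: rball_Suc)
    qed (use centre_in_rball[of v R q] in simp)
    then show False using Suc.prems eq by blast
  qed
  have "w \<notin> rball R q v" using Suc.prems(3) by (simp add: rball_Suc)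
  then have "q + 1 \<le> card (rball R q v)" using Suc fin by blast
  also have "\<dots> < card (rball R (Suc q) v)"
    using ne Suc.prems(1) by (intro psubset_card_mono) (auto simp: rball_Suc)
  finally show ?case by simp
qed simp

section \<open>Components and how spheres confine them\<close>

lemma component_in_induct [consumes 1, case_names base step]:
  assumes "y \<in> component_in R A x" "P x"
    and "\<And>a b. a \<in> component_in R A x \<Longrightarrow> P a \<Longrightarrow> (a, b) \<in> R \<Longrightarrow> a \<in> A \<Longrightarrow> b \<in> A \<Longrightarrow> P b"
  shows "P y"
proof -
  have "(x, y) \<in> (R \<inter> A \<times> A)\<^sup>*" using assms(1) by (simp add: component_in_def)
  then show ?thesis
    by (induction rule: rtrancl_induct) (use assms(2,3) in \<open>auto simp: component_in_def\<close>)
qed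

lemma component_in_self: "x \<in> component_in R A x"
  by (simp add: component_in_def)

lemma component_in_step:
  "a \<in> component_in R A x \<Longrightarrow> (a, b) \<in> R \<Longrightarrow> a \<in> A \<Longrightarrow> b \<in> A \<Longrightarrow> b \<in> component_in R A x"
  by (auto simp: component_in_def intro: rtrancl_into_rtrancl)

lemma component_in_subset: "x \<in> A \<Longrightarrow> component_in R A x \<subseteq> A"
  by (auto elim: component_in_induct)

lemma component_in_sym: "sym R \<Longrightarrow> y \<in> component_in R A x \<Longrightarrow> x \<in> component_in R A y"
  using sym_rtrancl[of "R \<inter> A \<times> A"] by (auto simp: component_in_def sym_def)

lemma component_in_mono: "A \<subseteq> B \<Longrightarrow> component_in R A x \<subseteq> component_in R B x"
  unfolding component_in_def by (intro Image_mono rtrancl_mono) auto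

text \<open>Distance from \<open>u\<close> grows by at most one per edge, so a path leaving the
  interior of the ball must meet the sphere of radius \<open>n\<close>, which \<open>Z\<close>
  blocks.\<close>

lemma component_inside_rball:
  assumes Z: "rsphere R n u \<subseteq> Z" and x: "x \<in> V - Z" "x \<in> rball R n u"
  shows "component_in R (V - Z) x \<subseteq> (\<Union>i<n. rball R i u)"
proof
  fix y assume "y \<in> component_in R (V - Z) x"
  then have "y \<in> (\<Union>i<n. rball R i u) \<and> y \<in> V - Z"
  proof (induction rule: component_in_induct)
    case base
    then show ?case using Z x by (auto simp: rsphere_def)
  next
    case (step a b)
    then obtain i where i: "i < n" "a \<in> rball R i u" by auto
    then have "b \<in> rball R (Suc i) u" using step by (auto simp: rball_Suc)
    then have "b \<in> rball R n u" using rball_mono[of "Suc i" n R u] i by auto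
    then show ?case using step Z by (auto simp: rsphere_def)
  qed
  then show "y \<in> (\<Union>i<n. rball R i u)" by blast
qed

text \<open>A vertex of the ball in the component of \<open>x\<close> would, by symmetry, have
  \<open>x\<close> in its own component, which \<open>component_inside_rball\<close> confines to the
  ball.\<close>

lemma component_outside_rball:
  assumes "sym R" "rsphere R n u \<subseteq> Z" "x \<in> V - Z" "x \<notin> rball R n u"
  shows "component_in R (V - Z) x \<inter> rball R n u = {}"
proof (rule ccontr)
  assume "\<not> ?thesis"
  then obtain y where y: "y \<in> component_in R (V - Z) x" "y \<in> rball R n u" by auto
  have yV: "y \<in> V - Z" using component_in_subset[OF assms(3)] y(1) by auto
  obtain i where "i < n" "x \<in> rball R i u"
    using component_inside_rball[OF assms(2) yV y(2)] component_in_sym[OF assms(1) y(1)] by auto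
  then show False using assms(4) rball_mono[of i n R u] by auto
qed

text \<open>In a finite relation \<open>card R\<close> steps reach everything reachable. Hence if no
  ball is heavy, no component is.\<close>

lemma component_in_rball:
  assumes "finite R"
  obtains n where "component_in R V x \<subseteq> rball R n x"
proof -
  have "component_in R V x \<subseteq> rball R (card R) x"
  proof
    fix y assume "y \<in> component_in R V x"
    then have "(x, y) \<in> R\<^sup>*"
      unfolding component_in_def using rtrancl_mono[of "R \<inter> V \<times> V" R] by auto
    then obtain n where n: "n \<le> card R" "(x, y) \<in> R ^^ n"
      using rtrancl_finite_eq_relpow[OF assms] by auto
    have "(x, z) \<in> R ^^ m \<Longrightarrow> z \<in> rball R m x" for m z
      by (induction m arbitrary: z) (auto simp: rball_Suc)
    then have "y \<in> rball R n x" using n by blast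
    then show "y \<in> rball R (card R) x" using rball_mono[OF n(1), of R x] by auto
  qed
  then show thesis by (rule that)
qed

text \<open>
  Let r be the least radius of a ball carrying more than half of W, centred at v say. All balls of
  radius less than r are light. Thin spheres around a net of a slightly larger ball around v cut
  that ball into light parts, and a thin sphere around v cuts off the light remainder.\<close>

lemma balanced_separator:
  fixes R :: "'a rel" and c :: real
  assumes V: "finite V" "R \<subseteq> V \<times> V" "sym R" and c: "c \<ge> 1"
    and lin: "\<And>v n. v \<in> V \<Longrightarrow> n \<ge> 1 \<Longrightarrow> real (card (rball R n v)) \<le> c * real n"
    and W: "W \<subseteq> V"
  shows "\<exists>Z. finite Z \<and> real (card Z) \<le> 14 * c\<^sup>2 + 3 * c \<and>
    (\<forall>x\<in>V - Z. 2 * card (component_in R (V - Z) x \<inter> W) \<le> card W)"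
proof -
  define heavy where "heavy n \<longleftrightarrow> (\<exists>v\<in>V. card W < 2 * card (rball R n v \<inter> W))" for n
  have finW: "finite W" using V W finite_subset by blast
  have finR: "finite R" using V finite_subset by blast
  have finB: "finite (rball R n v)" if "v \<in> V" for n v
    using rball_subset[OF V(2) that] V(1) finite_subset by blast
  \<comment> \<open>The separator is respectively empty, a single vertex that makes up all of
    \<open>W\<close>, or the union of thin spheres described above.\<close>
  consider "\<not> (\<exists>n. heavy n)" | "heavy 0" | "\<not> heavy 0" "\<exists>n. heavy n" by blast
  then show ?thesis
  proof cases
    case 1
    have "2 * card (component_in R (V - {}) x \<inter> W) \<le> card W" if x: "x \<in> V - {}" for x
    proof -
      obtain n where "component_in R (V - {}) x \<subseteq> rball R n x"
        by (rule component_in_rball[OF finR])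
      then have "card (component_in R (V - {}) x \<inter> W) \<le> card (rball R n x \<inter> W)"
        using finW by (intro card_mono) auto
      moreover have "2 * card (rball R n x \<inter> W) \<le> card W"
        using 1 x by (auto simp: heavy_def not_less)
      ultimately show ?thesis by simp
    qed
    then show ?thesis using c by (intro exI[of _ "{}"]) auto
  next
    case 2
    then obtain v where v: "v \<in> V" "card W < 2 * card ({v} \<inter> W)" by (auto simp: heavy_def)
    then have vW: "v \<in> W" by (cases "v \<in> W") auto
    then have "card (W - {v}) = 0" using v finW by simp
    then have "W - {v} = {}" using finW by (simp only: card_0_eq finite_Diff)
    then have "W = {v}" using vW by auto
    moreover have "v \<notin> component_in R (V - {v}) x" if "x \<in> V - {v}" for x
      using component_in_subset[OF that] by blast
    ultimately have "\<forall>x\<in>V - {v}. component_in R (V - {v}) x \<inter> W = {}" by blast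
    moreover have "1 \<le> 14 * c\<^sup>2 + 3 * c" using c by (smt (verit) zero_le_power2)
    ultimately show ?thesis by (intro exI[of _ "{v}"]) auto
  next
    case 3
    define r where "r = (LEAST n. heavy n)"
    have "heavy r" using 3(2) unfolding r_def by (rule LeastI_ex)
    then obtain v where v: "v \<in> V" "card W < 2 * card (rball R r v \<inter> W)" by (auto simp: heavy_def)
    have r: "r \<ge> 1" using 3(1) \<open>heavy r\<close> by (cases r) auto
    \<comment> \<open>The interior of a ball of radius at most \<open>r\<close> lies in the ball of
      radius \<open>r - 1\<close>, which is not heavy by minimality of \<open>r\<close>.\<close>
    have light: "2 * card (K \<inter> W) \<le> card W" if K: "K \<subseteq> (\<Union>i<n. rball R i u)" "n \<le> r" "u \<in> V" for K n u
    proof -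
      have "rball R i u \<subseteq> rball R (r - 1) u" if "i < n" for i
        using that K by (intro rball_mono) auto
      then have "card (K \<inter> W) \<le> card (rball R (r - 1) u \<inter> W)"
        using K finW by (intro card_mono) blast+
      moreover have "\<not> heavy (r - 1)"
        using r not_less_Least[of "r - 1" heavy] by (simp add: r_def)
      ultimately show ?thesis using K(3) by (auto simp: heavy_def)
    qed
    \<comment> \<open>A net at distance \<open>2 * q\<close> leaves at least half of the radii up to
      \<open>r\<close> for a thin sphere around each net point. The window from \<open>r\<close> to
      \<open>r + b\<close> does the same for the outer sphere around \<open>v\<close>.\<close>
    define q where "q = r div 4"
    define b where "b = r div 2"
    obtain s where s: "r \<le> s" "s \<le> r + b"
      "(r + b + 1 - r) * card (rsphere R s v) \<le> card (rball R (r + b) v)"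
      using ex_small_rsphere[OF finB[OF v(1)], of r "r + b"] by auto
    have sph_v: "real (card (rsphere R s v)) \<le> 3 * c"
    proof -
      have "real (b + 1) * real (card (rsphere R s v)) \<le> real (card (rball R (r + b) v))"
        using s(3) by (simp add: algebra_simps del: of_nat_add of_nat_Suc of_nat_mult flip: of_nat_mult)
      also have "\<dots> \<le> c * real (r + b)" using v r by (intro lin) auto
      \<comment> \<open>Here \<open>r \<le> 2 * b + 1\<close>, so
        \<open>r + b \<le> 3 * b + 1\<close>.\<close>
      also have "\<dots> \<le> c * (3 * real (b + 1))" using c by (intro mult_left_mono) (auto simp: b_def)
      finally have "real (b + 1) * real (card (rsphere R s v)) \<le> real (b + 1) * (3 * c)"
        by (simp add: algebra_simps)
      then show ?thesis by (rule mult_left_le_imp_le) simp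
    qed
    \<comment> \<open>A maximal family of centres with disjoint \<open>q\<close>-balls is a
      \<open>2 * q\<close>-net: a point farther than that from all of them could be added.\<close>
    define packing where "packing C \<longleftrightarrow> C \<subseteq> rball R s v \<and> pairwise (\<lambda>x y. rball R q x \<inter> rball R q y = {}) C"
      for C
    have "finite {C. packing C}"
      by (rule finite_subset[of _ "Pow (rball R s v)"]) (auto simp: packing_def finB v)
    moreover have "packing {}" by (simp add: packing_def)
    ultimately obtain C where C: "packing C" "\<And>D. packing D \<Longrightarrow> C \<subseteq> D \<Longrightarrow> C = D"
      using finite_has_maximal[of "{C. packing C}"] by blast
    have CV: "C \<subseteq> V" using C(1) rball_subset[OF V(2) v(1)] by (auto simp: packing_def)
    have finC: "finite C" using CV V finite_subset by blast
    have net: "\<exists>u\<in>C. x \<in> rball R (2 * q) u" if x: "x \<in> rball R s v" for x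
    proof (rule ccontr)
      assume no: "\<not> ?thesis"
      have "rball R q x \<inter> rball R q u = {}" if u: "u \<in> C" for u
      proof (rule ccontr)
        assume "rball R q x \<inter> rball R q u \<noteq> {}"
        then obtain z where "z \<in> rball R q x" "z \<in> rball R q u" by auto
        then have "x \<in> rball R (q + q) u" using rball_add rball_sym[OF V(3)] by metis
        then show False using no u by (simp add: mult_2)
      qed
      then have "packing (insert x C)"
        using C(1) x by (auto simp: packing_def pairwise_insert)
      then have "x \<in> C" using C(2)[of "insert x C"] by blast
      then show False using no centre_in_rball[of x R "2 * q"] by blast
    qed
    \<comment> \<open>The disjoint \<open>q\<close>-balls lie in the ball of radius
      \<open>s + q\<close> around \<open>v\<close>. If there are two centres, each
      \<open>q\<close>-ball has at least \<open>q + 1\<close> vertices, as another centre is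
      reachable but outside it; a single centre satisfies the bound directly.\<close>
    have card_C: "real (card C) \<le> 7 * c"
    proof (cases "\<exists>u\<in>C. \<exists>w\<in>C. u \<noteq> w")
      case False
      then have "card C \<le> 1" using finC by (auto simp: card_le_Suc0_iff_eq)
      then show ?thesis using c by linarith
    next
      case True
      have big: "q + 1 \<le> card (rball R q u)" if u: "u \<in> C" for u
      proof -
        obtain w where w: "w \<in> C" "w \<noteq> u" using True by metis
        have "u \<in> rball R s v" "w \<in> rball R s v" using u w C(1) by (auto simp: packing_def)
        then have "w \<in> rball R (s + s) u" using rball_add rball_sym[OF V(3)] by metis
        moreover have "w \<notin> rball R q u"
          using C(1) u w centre_in_rball[of w R q] by (auto simp: packing_def pairwise_def)
        ultimately show ?thesis using card_rball_ge[of R q u w "s + s"] finB CV u by blast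
      qed
      have "card C * (q + 1) \<le> (\<Sum>u\<in>C. card (rball R q u))"
        using sum_mono[of C "\<lambda>_. q + 1", OF big] by simp
      also have "\<dots> = card (\<Union>u\<in>C. rball R q u)"
        using C(1) finB CV by (subst card_UN_disjoint[OF finC]) (auto simp: packing_def pairwise_def)
      also have "\<dots> \<le> card (rball R (s + q) v)"
        using C(1) by (intro card_mono finB v) (auto simp: packing_def intro: rball_add)
      finally have "real (card C) * real (q + 1) \<le> real (card (rball R (s + q) v))"
        by (simp only: of_nat_le_iff flip: of_nat_mult)
      also have "\<dots> \<le> c * real (s + q)" using v r s by (intro lin) auto
      also have "\<dots> \<le> c * (7 * real (q + 1))"
      proof -
        \<comment> \<open>From \<open>r \<le> 4 * q + 3\<close> follows
          \<open>b \<le> 2 * q + 1\<close>, hence \<open>s \<le> 6 * q + 4\<close>.\<close>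
        have "s + q \<le> 7 * (q + 1)" using s(2) unfolding b_def q_def by presburger
        then have "real (s + q) \<le> 7 * real (q + 1)" by linarith
        then show ?thesis using c by (intro mult_left_mono) auto
      qed
      finally have "real (card C) * real (q + 1) \<le> 7 * c * real (q + 1)" by (simp add: algebra_simps)
      then show ?thesis by (rule mult_right_le_imp_le) simp
    qed
    \<comment> \<open>Radius at least \<open>2 * q\<close> keeps the net points' balls covering;
      radius at most \<open>r\<close> keeps their interiors light. As \<open>4 * q \<le> r\<close>,
      averaging over these radii gives \<open>2 * c\<close>.\<close>
    have "\<exists>i. 2 * q \<le> i \<and> i \<le> r \<and> real (card (rsphere R i u)) \<le> 2 * c" if u: "u \<in> C" for u
    proof -
      have uV: "u \<in> V" using u CV by auto
      obtain i where i: "2 * q \<le> i" "i \<le> r"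
        "(r + 1 - 2 * q) * card (rsphere R i u) \<le> card (rball R r u)"
        using ex_small_rsphere[OF finB[OF uV], of "2 * q" r] by (force simp: q_def)
      have "real (r + 1 - 2 * q) * real (card (rsphere R i u)) \<le> real (card (rball R r u))"
        using i(3) by (simp only: of_nat_le_iff flip: of_nat_mult)
      also have "\<dots> \<le> c * real r" using uV r by (intro lin) auto
      also have "\<dots> \<le> c * (2 * real (r + 1 - 2 * q))"
      proof -
        have "r \<le> 2 * (r + 1 - 2 * q)" unfolding q_def by linarith
        then have "real r \<le> 2 * real (r + 1 - 2 * q)" by linarith
        then show ?thesis using c by (intro mult_left_mono) auto
      qed
      finally have "real (r + 1 - 2 * q) * real (card (rsphere R i u)) \<le> real (r + 1 - 2 * q) * (2 * c)"
        by (simp add: algebra_simps)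
      moreover have "r + 1 - 2 * q > 0" unfolding q_def by linarith
      ultimately have "real (card (rsphere R i u)) \<le> 2 * c"
        by (metis mult_left_le_imp_le of_nat_0_less_iff)
      then show ?thesis using i by blast
    qed
    then obtain t where t: "\<And>u. u \<in> C \<Longrightarrow> 2 * q \<le> t u \<and> t u \<le> r \<and> real (card (rsphere R (t u) u)) \<le> 2 * c"
      by metis
    define Z where "Z = rsphere R s v \<union> (\<Union>u\<in>C. rsphere R (t u) u)"
    have finS: "finite (rsphere R i u)" if "u \<in> V" for i u
      using finB[OF that] rsphere_subset finite_subset by metis
    have "finite Z" unfolding Z_def using finC finS CV v(1) by auto
    \<comment> \<open>At most \<open>7 * c\<close> spheres of size at most \<open>2 * c\<close>,
      plus the outer one of size at most \<open>3 * c\<close>.\<close>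
    moreover have "real (card Z) \<le> 14 * c\<^sup>2 + 3 * c"
    proof -
      have "card Z \<le> card (rsphere R s v) + (\<Sum>u\<in>C. card (rsphere R (t u) u))"
        unfolding Z_def by (intro card_Un_le[THEN order_trans] add_left_mono card_UN_le finC)
      then have "real (card Z) \<le> real (card (rsphere R s v)) + (\<Sum>u\<in>C. real (card (rsphere R (t u) u)))"
        by (simp flip: of_nat_sum of_nat_add)
      also have "(\<Sum>u\<in>C. real (card (rsphere R (t u) u))) \<le> real (card C) * (2 * c)"
        using t by (intro sum_bounded_above) auto
      also have "real (card C) * (2 * c) \<le> 7 * c * (2 * c)"
        using card_C c by (intro mult_right_mono) auto
      finally show ?thesis using sph_v by (simp add: power2_eq_square)
    qed
    moreover have "2 * card (component_in R (V - Z) x \<inter> W) \<le> card W" if x: "x \<in> V - Z" for x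
    proof (cases "x \<in> rball R s v")
      case True
      then obtain u where u: "u \<in> C" "x \<in> rball R (2 * q) u" using net by blast
      then have "x \<in> rball R (t u) u" using rball_mono[of "2 * q" "t u" R u] t by blast
      moreover have "rsphere R (t u) u \<subseteq> Z" using u by (auto simp: Z_def)
      ultimately have "component_in R (V - Z) x \<subseteq> (\<Union>i<t u. rball R i u)"
        using x by (intro component_inside_rball)
      then show ?thesis using light[where n = "t u" and u = u] t u CV by blast
    next
      case False
      \<comment> \<open>The component avoids the ball of radius \<open>s \<ge> r\<close> around
        \<open>v\<close>, and the ball of radius \<open>r\<close> already holds more than half of
        \<open>W\<close>.\<close>
      have "component_in R (V - Z) x \<inter> rball R s v = {}"
        by (rule component_outside_rball[OF V(3) _ x False]) (simp add: Z_def)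
      then have "component_in R (V - Z) x \<inter> W \<subseteq> W - rball R r v"
        using rball_mono[OF s(1), of R v] by blast
      then have "card (component_in R (V - Z) x \<inter> W) \<le> card (W - rball R r v)"
        using finW by (intro card_mono) auto
      also have "\<dots> = card W - card (rball R r v \<inter> W)"
        using finW by (simp add: card_Diff_subset_Int Int_commute)
      finally show ?thesis using v(2) by linarith
    qed
    ultimately show ?thesis by blast
  qed
qed

subsection \<open>Layouts from balanced separators\<close>

definition nbrs :: "'a rel \<Rightarrow> 'a set \<Rightarrow> 'a set" where
  "nbrs R X = R `` X - X"

text \<open>
  Edges are to be coloured by the colour of their first end. The neighbours of X outside X count
  as preceding all of X.\<close>

definition good_order :: "'a rel \<Rightarrow> 'a set \<Rightarrow> ('a \<Rightarrow> nat) \<Rightarrow> ('a \<Rightarrow> nat) \<Rightarrow> bool" where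
  "good_order R X p col \<longleftrightarrow> inj_on p X \<and>
     (\<forall>v\<in>X. \<forall>x\<in>X. \<forall>y\<in>X. \<forall>u. p v < p x \<and> p x < p y \<and> (u, x) \<in> R \<and> (v, y) \<in> R \<and>
        (u \<in> X \<longrightarrow> p u < p v) \<longrightarrow> col u \<noteq> col v)"

lemma good_orderI:
  assumes "inj_on p X"
    and "\<And>u v x y. v \<in> X \<Longrightarrow> x \<in> X \<Longrightarrow> y \<in> X \<Longrightarrow> p v < p x \<Longrightarrow> p x < p y \<Longrightarrow> (u, x) \<in> R \<Longrightarrow>
      (v, y) \<in> R \<Longrightarrow> (u \<in> X \<Longrightarrow> p u < p v) \<Longrightarrow> col u \<noteq> col v"
  shows "good_order R X p col"
  using assms unfolding good_order_def by blast

lemma good_orderD: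
  assumes "good_order R X p col" "v \<in> X" "x \<in> X" "y \<in> X" "p v < p x" "p x < p y" "(u, x) \<in> R"
    "(v, y) \<in> R" "u \<in> X \<Longrightarrow> p u < p v"
  shows "col u \<noteq> col v"
  using assms unfolding good_order_def by blast

text \<open>On a finite \<open>X\<close> the sum of \<open>p\<close> bounds every value of
  \<open>p\<close>, also when \<open>X\<close> is empty, so the shift puts everything else after
  \<open>X\<close>.\<close>

definition order_append :: "'a set \<Rightarrow> ('a \<Rightarrow> nat) \<Rightarrow> ('a \<Rightarrow> nat) \<Rightarrow> 'a \<Rightarrow> nat" where
  "order_append X p q x = (if x \<in> X then p x else Suc (sum p X) + q x)"

lemma order_append_left [simp]: "x \<in> X \<Longrightarrow> order_append X p q x = p x"
  and order_append_right [simp]: "x \<notin> X \<Longrightarrow> order_append X p q x = Suc (sum p X) + q x"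
  by (simp_all add: order_append_def)

lemma order_append_less: "finite X \<Longrightarrow> x \<in> X \<Longrightarrow> y \<notin> X \<Longrightarrow> order_append X p q x < order_append X p q y"
  using member_le_sum[of x X p] by simp

lemma inj_on_order_append:
  assumes "finite X" "inj_on p X" "inj_on q Y" "X \<inter> Y = {}"
  shows "inj_on (order_append X p q) (X \<union> Y)"
proof (rule inj_onI)
  fix x y assume xy: "x \<in> X \<union> Y" "y \<in> X \<union> Y" and eq: "order_append X p q x = order_append X p q y"
  have "x \<in> X \<longleftrightarrow> y \<in> X"
    using order_append_less[OF assms(1), of x y p q] order_append_less[OF assms(1), of y x p q] eq
    by auto
  then show "x = y" using xy eq assms by (cases "x \<in> X") (auto dest: inj_onD)
qed

text \<open>A neighbour outside \<open>Z\<close> cannot lie in \<open>X\<close>, since the component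
  would absorb it; so it is an old neighbour of \<open>X\<close>, reached within
  \<open>V - Z\<close>. A separator balanced for \<open>nbrs R X\<close> thereby bounds the new
  neighbourhoods.\<close>

lemma nbrs_component_subset:
  assumes "x \<in> X - Z" "R \<subseteq> V \<times> V" "X \<subseteq> V"
  shows "nbrs R (component_in R (X - Z) x)
    \<subseteq> Z \<union> (component_in R (V - Z) x \<inter> nbrs R X)"
proof
  fix u assume "u \<in> nbrs R (component_in R (X - Z) x)"
  then obtain y where y: "y \<in> component_in R (X - Z) x" "(y, u) \<in> R" "u \<notin> component_in R (X - Z) x"
    by (auto simp: nbrs_def)
  have yX: "y \<in> X - Z" using component_in_subset[OF assms(1)] y(1) by blast
  have "y \<in> component_in R (V - Z) x"
    using component_in_mono[of "X - Z" "V - Z" R x] assms(3) y(1) by blast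
  then have "u \<in> component_in R (V - Z) x" if "u \<notin> Z"
    using component_in_step[of y R "V - Z" x u] y(2) yX that assms by blast
  moreover have "u \<notin> X" if "u \<notin> Z"
    using component_in_step[of y R "X - Z" x u] y yX that by blast
  ultimately show "u \<in> Z \<union> (component_in R (V - Z) x \<inter> nbrs R X)"
    using y(2) yX by (auto simp: nbrs_def)
qed

text \<open>The colours of \<open>N\<close> exclude at most \<open>card N\<close> of the
  \<open>m\<close> colours, which leaves enough for \<open>D\<close>.\<close>

lemma extend_colouring:
  assumes "finite D" "finite N" "D \<inter> N = {}" "card N + card D \<le> m"
  obtains col' where "\<And>x. x \<notin> D \<Longrightarrow> col' x = col x" "inj_on col' D" "col' ` D \<subseteq> {..<m}"
    "col' ` D \<inter> col ` N = {}"
proof -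
  have "card D \<le> card ({..<m} - col ` N)"
    using assms card_image_le[of N col] diff_card_le_card_Diff[of "col ` N" "{..<m}"] by simp
  then obtain f where f: "f ` D \<subseteq> {..<m} - col ` N" "inj_on f D"
    using card_le_inj[of D "{..<m} - col ` N"] assms(1) by auto
  define g where "g x = (if x \<in> D then f x else col x)" for x
  have "g ` D = f ` D" "inj_on g D" using f(2) by (auto simp: g_def inj_on_def)
  then show thesis using f(1) by (intro that[of g]) (auto simp: g_def)
qed

text \<open>Induction on \<open>card X\<close>. A disconnected \<open>X\<close> is split along a
  component; a connected one starts with a bag \<open>D\<close> of new vertices, and the rest
  follows recursively. Colours outside \<open>X\<close> are prescribed by an arbitrary
  \<open>col\<close>: in each constraint \<open>v\<close> lies in \<open>X\<close>, so two outside
  vertices are never compared.\<close>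

lemma good_order_exists:
  fixes R :: "'a rel" and k :: nat
  assumes V: "finite V" "R \<subseteq> V \<times> V" "sym R"
    and sep: "\<And>W. W \<subseteq> V \<Longrightarrow> \<exists>Z. finite Z \<and> card Z \<le> k \<and>
      (\<forall>x\<in>V - Z. 2 * card (component_in R (V - Z) x \<inter> W) \<le> card W)"
    and X: "X \<subseteq> V" "\<And>x. x \<in> X \<Longrightarrow> card (nbrs R (component_in R X x)) \<le> 2 * k + 1"
  shows "\<exists>p col'. (\<forall>x. x \<notin> X \<longrightarrow> col' x = col x) \<and> col' ` X \<subseteq> {..<3 * k + 1} \<and> good_order R X p col'"
  using X
proof (induction "card X" arbitrary: X col rule: less_induct)
  case less
  have finX: "finite X" using less.prems V finite_subset by blast
  have symR: "\<And>a b. (a, b) \<in> R \<Longrightarrow> (b, a) \<in> R" using V(3) by (auto simp: sym_def)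
  consider "X = {}" | x where "x \<in> X" "component_in R X x \<noteq> X"
    | z where "z \<in> X" "\<And>x. x \<in> X \<Longrightarrow> component_in R X x = X" by blast
  then show ?case
  proof cases
    case 1
    then show ?thesis by (intro exI[of _ "\<lambda>_. 0"] exI[of _ col]) (auto simp: good_order_def)
  next
    case 2
    define Y where "Y = component_in R X x"
    have YX: "Y \<subset> X" using 2 component_in_subset[of x X R] by (auto simp: Y_def)
    have xY: "x \<in> Y" by (simp add: Y_def component_in_self)
    have closed: "b \<in> Y" if "(a, b) \<in> R" "a \<in> Y" "b \<in> X" for a b
      using that YX component_in_step[of a R X x b] by (auto simp: Y_def)
    have comp_Y: "component_in R Y a = component_in R X a" if a: "a \<in> Y" for a
    proof
      show "component_in R Y a \<subseteq> component_in R X a" using YX by (intro component_in_mono) auto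
      show "component_in R X a \<subseteq> component_in R Y a"
      proof
        fix b assume "b \<in> component_in R X a"
        then have "b \<in> Y \<and> b \<in> component_in R Y a"
          by (induction rule: component_in_induct)
            (use a closed component_in_self component_in_step in \<open>fast+\<close>)
        then show "b \<in> component_in R Y a" ..
      qed
    qed
    have comp_XY: "component_in R (X - Y) a = component_in R X a" if a: "a \<in> X - Y" for a
    proof
      show "component_in R (X - Y) a \<subseteq> component_in R X a" by (intro component_in_mono) auto
      show "component_in R X a \<subseteq> component_in R (X - Y) a"
      proof
        fix b assume "b \<in> component_in R X a"
        then have "b \<in> X - Y \<and> b \<in> component_in R (X - Y) a"
        proof (induction rule: component_in_induct)
          case (step c d)
          then have "d \<in> X - Y" using closed[of d c] symR by blast
          then show ?case using step component_in_step[of c R "X - Y" a d] by blast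
        qed (use a component_in_self in fast)
        then show "b \<in> component_in R (X - Y) a" ..
      qed
    qed
    \<comment> \<open>\<open>Y\<close> is ordered and coloured first, then \<open>X - Y\<close>
      starting from the resulting colouring. No edge joins the two, so no crossing mixes
      them.\<close>
    have "card Y < card X" using YX finX by (rule psubset_card_mono[rotated])
    then obtain p1 col1 where 1: "\<And>x. x \<notin> Y \<Longrightarrow> col1 x = col x" "col1 ` Y \<subseteq> {..<3 * k + 1}"
      "good_order R Y p1 col1"
    proof -
      have "Y \<subseteq> V" using YX less.prems(1) by blast
      moreover have "card (nbrs R (component_in R Y a)) \<le> 2 * k + 1" if "a \<in> Y" for a
        using that YX comp_Y[OF that] less.prems(2)[of a] by auto
      ultimately show ?thesis using less.hyps[OF \<open>card Y < card X\<close>, of col] that by blast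
    qed
    have "card (X - Y) < card X" using YX finX xY by (intro psubset_card_mono) auto
    then obtain p2 col2 where 2: "\<And>x. x \<notin> X - Y \<Longrightarrow> col2 x = col1 x"
      "col2 ` (X - Y) \<subseteq> {..<3 * k + 1}" "good_order R (X - Y) p2 col2"
    proof -
      have "X - Y \<subseteq> V" using less.prems(1) by blast
      moreover have "card (nbrs R (component_in R (X - Y) a)) \<le> 2 * k + 1" if "a \<in> X - Y" for a
        using that comp_XY[OF that] less.prems(2)[of a] by auto
      ultimately show ?thesis using less.hyps[OF \<open>card (X - Y) < card X\<close>, of col1] that by blast
    qed
    have finY: "finite Y" using YX finX finite_subset by auto
    let ?p = "order_append Y p1 p2"
    have "good_order R X ?p col2"
    proof (rule good_orderI)
      have "inj_on ?p (Y \<union> (X - Y))"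
        using 1(3) 2(3) by (intro inj_on_order_append finY) (auto simp: good_order_def)
      then show "inj_on ?p X" using YX by (simp add: Un_absorb1 psubset_imp_subset)
    next
      fix u v x y
      assume vxy: "v \<in> X" "x \<in> X" "y \<in> X" "?p v < ?p x" "?p x < ?p y" and E: "(u, x) \<in> R" "(v, y) \<in> R"
        and u: "u \<in> X \<Longrightarrow> ?p u < ?p v"
      have down: "a \<in> Y" if "b \<in> Y" "?p a < ?p b" for a b
        using that order_append_less[OF finY, of b a p1 p2] by fastforce
      show "col2 u \<noteq> col2 v"
      proof (cases "v \<in> Y")
        case True
        then have "y \<in> Y" using closed E vxy by blast
        then have "x \<in> Y" using down vxy by blast
        have "u \<notin> X - Y" using u down True by blast
        moreover have "col1 u \<noteq> col1 v"
          by (rule good_orderD[OF 1(3) True \<open>x \<in> Y\<close> \<open>y \<in> Y\<close> _ _ E])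
            (use vxy True \<open>x \<in> Y\<close> \<open>y \<in> Y\<close> u YX in auto)
        ultimately show ?thesis using 2(1) True by simp
      next
        case False
        then have "x \<notin> Y" "y \<notin> Y" using down vxy by blast+
        then show ?thesis
          by (intro good_orderD[OF 2(3) _ _ _ _ _ E]) (use vxy False u in auto)
      qed
    qed
    moreover have "col2 ` X \<subseteq> {..<3 * k + 1}"
    proof
      fix c assume "c \<in> col2 ` X"
      then obtain a where "a \<in> X" "c = col2 a" by auto
      then show "c \<in> {..<3 * k + 1}" using 1(2) 2(1)[of a] 2(2) by (cases "a \<in> Y") auto
    qed
    moreover have "\<forall>x. x \<notin> X \<longrightarrow> col2 x = col x" using 1(1) 2(1) YX by auto
    ultimately show ?thesis by blast
  next
    case 3
    let ?N = "nbrs R X"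
    have NV: "?N \<subseteq> V" using V(2) by (auto simp: nbrs_def)
    have finN: "finite ?N" using NV V(1) finite_subset by blast
    have card_N: "card ?N \<le> 2 * k + 1" using less.prems(2)[OF 3(1)] 3 by simp
    \<comment> \<open>If \<open>nbrs R X\<close> has room for one more vertex, any single vertex
      serves as \<open>D\<close>. If it has exactly \<open>2 * k + 1\<close> elements,
      \<open>D\<close> is the part in \<open>X\<close> of a separator balanced for it.\<close>
    have "\<exists>D\<subseteq>X. D \<noteq> {} \<and> card ?N + card D \<le> 3 * k + 1 \<and>
        (\<forall>x\<in>X - D. card (nbrs R (component_in R (X - D) x)) \<le> 2 * k + 1)"
    proof (cases "card ?N \<le> 2 * k")
      case True
      have "card (nbrs R (component_in R (X - {z}) x)) \<le> 2 * k + 1" if x: "x \<in> X - {z}" for x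
      proof -
        have "nbrs R (component_in R (X - {z}) x) \<subseteq> insert z ?N"
          using nbrs_component_subset[OF x V(2) less.prems(1)] by blast
        then have "card (nbrs R (component_in R (X - {z}) x)) \<le> card (insert z ?N)"
          using finN by (intro card_mono) auto
        also have "\<dots> \<le> Suc (card ?N)" by (rule card_insert_le_m1) auto
        finally show ?thesis using True by simp
      qed
      then show ?thesis using True 3(1) by (intro exI[of _ "{z}"]) auto
    next
      case False
      then have N: "card ?N = 2 * k + 1" using card_N by simp
      obtain Z where Z: "finite Z" "card Z \<le> k"
        "\<And>x. x \<in> V - Z \<Longrightarrow> 2 * card (component_in R (V - Z) x \<inter> ?N) \<le> card ?N"
        using sep[OF NV] by blast
      have small: "card (nbrs R (component_in R (X - Z) x)) \<le> 2 * k" if x: "x \<in> X - Z" for x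
      proof -
        let ?C = "component_in R (V - Z) x \<inter> ?N"
        have "card (nbrs R (component_in R (X - Z) x)) \<le> card (Z \<union> ?C)"
          using nbrs_component_subset[OF x V(2) less.prems(1)] Z(1) finN by (intro card_mono) auto
        also have "\<dots> \<le> card Z + card ?C" by (rule card_Un_le)
        \<comment> \<open>Since \<open>2 * k + 1\<close> is odd, half of it rounds down to
          \<open>k\<close>, and the new neighbourhood has at most \<open>k + k\<close>
          vertices.\<close>
        also have "2 * card ?C \<le> 2 * k + 1" using Z(3)[of x] x less.prems(1) N by auto
        then have "card Z + card ?C \<le> 2 * k" using Z(2) by linarith
        finally show ?thesis .
      qed
      \<comment> \<open>Progress: a \<open>Z\<close> missing \<open>X\<close> would leave the
        connected \<open>X\<close> intact with all its \<open>2 * k + 1\<close> neighbours,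
        contradicting \<open>small\<close>.\<close>
      have "X \<inter> Z \<noteq> {}"
      proof
        assume "X \<inter> Z = {}"
        then have "X - Z = X" by blast
        then show False using small[of z] 3 N by simp
      qed
      moreover have "card (X \<inter> Z) \<le> k" using card_mono[of Z "X \<inter> Z"] Z by simp
      moreover have "X - X \<inter> Z = X - Z" by blast
      ultimately show ?thesis using N small by (intro exI[of _ "X \<inter> Z"]) force
    qed
    then obtain D where D: "D \<subseteq> X" "D \<noteq> {}" "card ?N + card D \<le> 3 * k + 1"
      "\<And>x. x \<in> X - D \<Longrightarrow> card (nbrs R (component_in R (X - D) x)) \<le> 2 * k + 1" by blast
    have finD: "finite D" using D(1) finX finite_subset by auto
    have "D \<inter> ?N = {}" using D(1) by (auto simp: nbrs_def)
    then obtain col1 where 1: "\<And>x. x \<notin> D \<Longrightarrow> col1 x = col x" "inj_on col1 D"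
      "col1 ` D \<subseteq> {..<3 * k + 1}" "col1 ` D \<inter> col ` ?N = {}"
      using extend_colouring[OF finD finN _ D(3)] by metis
    have "card (X - D) < card X" using D finX by (intro psubset_card_mono) auto
    then obtain p2 col2 where 2: "\<And>x. x \<notin> X - D \<Longrightarrow> col2 x = col1 x"
      "col2 ` (X - D) \<subseteq> {..<3 * k + 1}" "good_order R (X - D) p2 col2"
    proof -
      have "X - D \<subseteq> V" using less.prems(1) by blast
      then show ?thesis using less.hyps[OF \<open>card (X - D) < card X\<close>, of col1] D(4) that by blast
    qed
    \<comment> \<open>Any order within \<open>D\<close> will do, as its colours are pairwise
      distinct.\<close>
    obtain p1 :: "'a \<Rightarrow> nat" where p1: "inj_on p1 D"
      using finite_imp_inj_to_nat_seg[OF finD] by blast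
    let ?p = "order_append D p1 p2"
    have "good_order R X ?p col2"
    proof (rule good_orderI)
      have "inj_on ?p (D \<union> (X - D))"
        using p1 2(3) by (intro inj_on_order_append finD) (auto simp: good_order_def)
      then show "inj_on ?p X" using D(1) by (simp add: Un_absorb1)
    next
      fix u v x y
      assume vxy: "v \<in> X" "x \<in> X" "y \<in> X" "?p v < ?p x" "?p x < ?p y" and E: "(u, x) \<in> R" "(v, y) \<in> R"
        and u: "u \<in> X \<Longrightarrow> ?p u < ?p v"
      have down: "a \<in> D" if "b \<in> D" "?p a < ?p b" for a b
        using that order_append_less[OF finD, of b a p1 p2] by fastforce
      show "col2 u \<noteq> col2 v"
      \<comment> \<open>For \<open>v\<close> in \<open>D\<close>, the earlier end \<open>u\<close>
        is in \<open>D\<close> or an outside neighbour of \<open>X\<close>, and both kinds have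
        colours different from that of \<open>v\<close>. Otherwise \<open>v\<close>,
        \<open>x\<close> and \<open>y\<close> all lie in \<open>X - D\<close>, where a
        \<open>u\<close> in \<open>D\<close> counts as an outside neighbour.\<close>
      proof (cases "v \<in> D")
        case True
        have v2: "col2 v = col1 v" using 2(1) True by simp
        show ?thesis
        proof (cases "u \<in> X")
          case True
          then have "u \<in> D" "u \<noteq> v" using u down[OF \<open>v \<in> D\<close>, of u] by blast+
          then show ?thesis using 1(2) 2(1)[of u] v2 \<open>v \<in> D\<close> by (auto dest: inj_onD)
        next
          case False
          then have "u \<in> ?N" using E(1) symR vxy by (auto simp: nbrs_def)
          moreover have "col2 u = col u" using 1(1)[of u] 2(1)[of u] False D(1) by auto
          ultimately show ?thesis using 1(4) v2 \<open>v \<in> D\<close> by auto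
        qed
      next
        case False
        then have "x \<notin> D" "y \<notin> D" using down vxy by blast+
        then show ?thesis
          by (intro good_orderD[OF 2(3) _ _ _ _ _ E]) (use vxy False u in auto)
      qed
    qed
    moreover have "col2 ` X \<subseteq> {..<3 * k + 1}"
    proof
      fix c assume "c \<in> col2 ` X"
      then obtain a where "a \<in> X" "c = col2 a" by auto
      then show "c \<in> {..<3 * k + 1}" using 1(3) 2(1)[of a] 2(2) by (cases "a \<in> D") auto
    qed
    moreover have "\<forall>x. x \<notin> X \<longrightarrow> col2 x = col x"
    proof (intro allI impI)
      fix x assume "x \<notin> X"
      then show "col2 x = col x" using 1(1)[of x] 2(1)[of x] D(1) by auto
    qed
    ultimately show ?thesis by blast
  qed
qed

text \<open>The recursion starts at \<open>X = V\<close>, whose components have no outside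
  neighbours.\<close>

lemma has_stack_layout_finite:
  assumes G: "graph V E" and V: "finite V"
    and R: "R = {(u, v). u \<in> V \<and> v \<in> V \<and> {u, v} \<in> E}"
    and sep: "\<And>W. W \<subseteq> V \<Longrightarrow> \<exists>Z. finite Z \<and> card Z \<le> k \<and>
      (\<forall>x\<in>V - Z. 2 * card (component_in R (V - Z) x \<inter> W) \<le> card W)"
  shows "has_stack_layout V E (3 * k + 1)"
proof -
  have RV: "R \<subseteq> V \<times> V" "sym R" by (auto simp: R sym_def insert_commute)
  have "nbrs R (component_in R V x) = {}" if "x \<in> V" for x
    using component_in_step[of _ R V x] RV(1) by (fastforce simp: nbrs_def)
  then obtain p col where p: "col ` V \<subseteq> {..<3 * k + 1}" "good_order R V p col"
    using good_order_exists[OF V RV sep, of V "\<lambda>_. 0"] by auto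
  define L where "L = {(u, v). u \<in> V \<and> v \<in> V \<and> p u \<le> p v}"
  \<comment> \<open>The colour of the first end; \<open>Suc\<close> because layout colours start at
    1.\<close>
  define phi where "phi e = Suc (col (arg_min_on p e))" for e
  have inj: "inj_on p V" using p(2) by (simp add: good_order_def)
  have Ls: "u \<in> V \<and> v \<in> V \<and> p u < p v" if "(u, v) \<in> L \<and> u \<noteq> v" for u v
    using that inj by (auto simp: L_def inj_on_def order_le_less)
  have phi: "phi {u, x} = Suc (col u)" if "p u < p x" for u x
  proof -
    have "arg_min_on p {u, x} = u"
      using arg_min_if_finite[of "{u, x}" p] that by auto
    then show ?thesis by (simp add: phi_def)
  qed
  have "linear_order_on V L"
    using inj by (auto simp: L_def order_on_defs refl_on_def trans_def antisym_def total_on_def inj_on_def)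
  moreover have "phi e \<in> {1..3 * k + 1}" if e: "e \<in> E" for e
  proof -
    obtain u v where uv: "e = {u, v}" "u \<in> V" "v \<in> V" using G e by (auto simp: graph_def)
    then have "arg_min_on p e \<in> V" using arg_min_if_finite(1)[of e p] by auto
    then have "col (arg_min_on p e) < 3 * k + 1" using p(1) by blast
    then show ?thesis by (simp add: phi_def)
  qed
  moreover have "phi {u, x} \<noteq> phi {v, y}"
    if E: "{u, x} \<in> E" "{v, y} \<in> E" and
      o: "(u, v) \<in> L \<and> u \<noteq> v" "(v, x) \<in> L \<and> v \<noteq> x" "(x, y) \<in> L \<and> x \<noteq> y" for u v x y
  proof -
    have lt: "p u < p v" "p v < p x" "p x < p y" "u \<in> V" "v \<in> V" "x \<in> V" "y \<in> V"
      using Ls o by blast+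
    then have "col u \<noteq> col v"
      using E by (intro good_orderD[OF p(2), of v x y u]) (auto simp: R)
    then show ?thesis using lt phi[of u x] phi[of v y] by auto
  qed
  ultimately show ?thesis unfolding has_stack_layout_def stack_layout_def
    by (intro exI[of _ L] exI[of _ phi]) simp
qed

section \<open>Walks, balls and growth\<close>

lemma walk_within_mono: "walk_within F m v w \<Longrightarrow> m \<le> n \<Longrightarrow> walk_within F n v w"
  unfolding walk_within_def by (metis add_le_mono1 order_trans)

lemma walk_within_refl: "walk_within F n v v"
  unfolding walk_within_def by (intro exI[of _ "[v]"]) auto

lemma walk_within_step:
  assumes "walk_within F n v w" "{w, x} \<in> F"
  shows "walk_within F (Suc n) v x"
proof -
  obtain ps where ps: "ps \<noteq> []" "length ps \<le> n + 1" "hd ps = v" "last ps = w"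
    "\<And>i. i + 1 < length ps \<Longrightarrow> {ps ! i, ps ! (i + 1)} \<in> F"
    using assms(1) by (auto simp: walk_within_def)
  have "{(ps @ [x]) ! i, (ps @ [x]) ! (i + 1)} \<in> F" if "i + 1 < length (ps @ [x])" for i
  proof (cases "i + 1 < length ps")
    case True
    then show ?thesis using ps(5)[of i] by (simp add: nth_append)
  next
    case False
    then have "i = length ps - 1" using that ps(1) by auto
    then show ?thesis using assms(2) ps by (simp add: nth_append last_conv_nth)
  qed
  then show ?thesis unfolding walk_within_def
    using ps by (intro exI[of _ "ps @ [x]"]) auto
qed

text \<open>The ball with all edges of \<open>E\<close> inside it is a subgraph of radius at most
  \<open>n\<close> centred at \<open>v\<close>. This transfers the growth bound to balls of finite
  induced subgraphs.\<close>

lemma card_rball_le_growth: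
  assumes R: "R = {(u, v). u \<in> W \<and> v \<in> W \<and> {u, v} \<in> E}" and W: "finite W" "W \<subseteq> V" and v: "v \<in> W"
  shows "enat (card (rball R n v)) \<le> growth V E n"
proof -
  let ?B = "rball R n v"
  let ?F = "{e \<in> E. e \<subseteq> ?B}"
  have BW: "?B \<subseteq> W" using v by (intro rball_subset) (auto simp: R)
  \<comment> \<open>The edge set stays that of the ball of radius \<open>n\<close> while
    \<open>m\<close> varies, so that the induction can extend walks within it.\<close>
  have walk: "walk_within ?F m v w" if "w \<in> rball R m v" "m \<le> n" for m w
    using that
  proof (induction m arbitrary: w)
    case 0
    then show ?case by (simp add: walk_within_refl)
  next
    case (Suc m)
    show ?case
    proof (cases "w \<in> rball R m v")
      case True
      then show ?thesis using Suc walk_within_mono[of ?F m v w "Suc m"] by simp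
    next
      case False
      then obtain u where u: "u \<in> rball R m v" "(u, w) \<in> R" using Suc.prems by (auto simp: rball_Suc)
      have "u \<in> ?B" "w \<in> ?B"
        using u Suc.prems rball_mono[of m n R v] rball_mono[of "Suc m" n R v] by auto
      then have "{u, w} \<in> ?F" using u by (auto simp: R)
      moreover have "walk_within ?F m v u" using Suc.IH u Suc.prems by simp
      ultimately show ?thesis by (rule walk_within_step[rotated])
    qed
  qed
  have "radius_le ?B ?F n"
    unfolding radius_le_def using walk centre_in_rball[of v R n] by auto
  then have "(?B, ?F) \<in> {(W, F). subgraph W F V E \<and> radius_le W F n}"
    using BW W by (auto simp: subgraph_def)
  then have "ecard (fst (?B, ?F)) \<le> growth V E n"
    unfolding growth_def by (rule SUP_upper)
  then show ?thesis using finite_subset[OF BW W(1)] by (simp add: ecard_def)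
qed

subsection \<open>Stack-number\<close>

theorem theorem2:
  fixes V :: "'a set" and E :: "'a set set" and c :: real
  assumes "graph V E"
    and "c \<ge> 1"
    and "\<forall>r::nat. r \<ge> 1 \<longrightarrow> growth V E r \<noteq> \<infinity> \<and> real (the_enat (growth V E r)) \<le> c * real r"
  shows "\<exists>k::nat. real k \<le> 49 * c\<^sup>2 + 30 * c + 1 \<and> stack_number V E = enat k"
proof -
  \<comment> \<open>The floor suffices because separator sizes are integers.\<close>
  define k where "k = nat \<lfloor>14 * c\<^sup>2 + 3 * c\<rfloor>"
  have nonneg: "0 \<le> 14 * c\<^sup>2 + 3 * c" using assms(2) by simp
  have "has_stack_layout W {e \<in> E. e \<subseteq> W} (3 * k + 1)" if W: "finite W" "W \<subseteq> V" for W
  proof (rule has_stack_layout_finite[OF _ W(1) refl])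
    show "graph W {e \<in> E. e \<subseteq> W}" using assms(1) by (fastforce simp: graph_def)
    define R where "R = {(u, v). u \<in> W \<and> v \<in> W \<and> {u, v} \<in> {e \<in> E. e \<subseteq> W}}"
    have R: "R = {(u, v). u \<in> W \<and> v \<in> W \<and> {u, v} \<in> E}" by (auto simp: R_def)
    have RW: "R \<subseteq> W \<times> W" "sym R" by (auto simp: R sym_def insert_commute)
    have lin: "real (card (rball R n v)) \<le> c * real n" if v: "v \<in> W" and n: "n \<ge> 1" for v n
    proof -
      obtain m where m: "growth V E n = enat m" "real m \<le> c * real n"
        using assms(3) n by fastforce
      then have "card (rball R n v) \<le> m"
        using card_rball_le_growth[OF R W v, of n] by simp
      then show ?thesis using m(2) by linarith
    qed
    fix S assume S: "S \<subseteq> W"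
    obtain Z where Z: "finite Z" "real (card Z) \<le> 14 * c\<^sup>2 + 3 * c"
      "\<forall>x\<in>W - Z. 2 * card (component_in R (W - Z) x \<inter> S) \<le> card S"
      using balanced_separator[OF W(1) RW assms(2) lin S] by blast
    have "card Z \<le> k" using Z(2) unfolding k_def by (simp add: le_nat_floor)
    then show "\<exists>Z. finite Z \<and> card Z \<le> k \<and> (\<forall>x\<in>W - Z. 2 * card (component_in
        {(u, v). u \<in> W \<and> v \<in> W \<and> {u, v} \<in> {e \<in> E. e \<subseteq> W}} (W - Z) x \<inter> S) \<le> card S)"
      using Z unfolding R_def by blast
  qed
  then have layout: "has_stack_layout V E (3 * k + 1)"
    by (rule has_stack_layout_compactness[OF assms(1)])
  define s where "s = (LEAST k. has_stack_layout V E k)"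
  have "s \<le> 3 * k + 1" unfolding s_def using layout by (rule Least_le)
  then have "real s \<le> 3 * real k + 1" by linarith
  also have "real k \<le> 14 * c\<^sup>2 + 3 * c" unfolding k_def using nonneg by linarith
  \<comment> \<open>The left side is at most \<open>42 * c\<^sup>2 + 9 * c + 1\<close>.\<close>
  then have "3 * real k + 1 \<le> 49 * c\<^sup>2 + 30 * c + 1"
    using assms(2) zero_le_power2[of c] by linarith
  finally have "real s \<le> 49 * c\<^sup>2 + 30 * c + 1" .
  moreover have "stack_number V E = enat s"
    using layout by (auto simp: stack_number_def s_def)
  ultimately show ?thesis by blast
qed

end
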